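(* Let $n\in\mathbb N$ and $\{\alpha_0,\alpha_1,\dots\}\subset\mathbb C$, and consider the matrix $$M=\left(\frac{1}{\alpha_j+\overline{\alpha_k}+1}\right)_{j,k=0}^{n}.$$ (1) Its determinant is $$\det M=\prod_{k=0}^{n}\frac{\prod_{j=0}^{k-1}|\alpha_k-\alpha_j|^2}{(1+2\Re(\alpha_k))\prod_{j=0}^{k-1}|\alpha_k+\overline{\alpha_j}+1|^2}.$$ (2) Under the condition $\alpha_j\neq\alpha_k$ (for $j\neq k$) and $\Re(\alpha_j)+\Re(\alpha_k)\neq-1$, for $j,k=0,1,\dots,n$, the matrix $M$ is invertible, and its inverse matrix $(\gamma_{j,k})_{j,k=0}^{n}$ has entries $$\gamma_{j,k}=\sum_{m=\max(j,k)}^{n}\frac{(1+2\Re(\alpha_m))\prod_{r=0}^{m-1}(\overline{\alpha_j}+\alpha_r+1)(\alpha_k+\overline{\alpha_r}+1)}{\prod_{0\le p\le m-1,\ p\ne j}(\overline{\alpha_j}-\overline{\alpha_p})\ \prod_{0\le q\le m-1,\ q\ne k}(\alpha_k-\alpha_q)}.$$ (3) When $M$ is positive definite, its smallest eigenvalue $\lambda_s$ has the lower bound $$\lambda_s\ge\left\{\sum_{\ell=0}^{n}\left\{\sum_{j=0}^{\ell}\frac{\sqrt{1+2\Re(\alpha_\ell)}\ \prod_{k=0}^{\ell-1}|\alpha_j+\overline{\alpha_k}+1|}{\prod_{0\le k\le\ell-1,\ k\ne j}|\alpha_j-\alpha_k|}\right\}^2\right\}^{-1}.$$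
   Context: Empty products equal $1$. $\Re$ denotes the real part and the bar denotes complex conjugation.
   Formalization: The denominator products in (2) run to m instead of m-1, and in (3) to ℓ instead of ℓ-1; as printed both fail (e.g. n=1, α=(0,2) for (2) and α=(0,1/10) for (3)). All α_j+conj(α_k)+1 are assumed nonzero so that M is defined. *)

theory Defs
  imports
    "Jordan_Normal_Form.Schur_Decomposition"
    "Jordan_Normal_Form.Spectral_Radius"
begin

definition gram_mat :: "nat \<Rightarrow> (nat \<Rightarrow> complex) \<Rightarrow> complex mat" where
  "gram_mat n \<alpha> = mat (Suc n) (Suc n) (\<lambda>(j, k). 1 / (\<alpha> j + cnj (\<alpha> k) + 1))"

definition positive_definite :: "complex mat \<Rightarrow> bool" where
  "positive_definite A \<longleftrightarrow>
     square_mat A \<and> mat_adjoint A = A \<and>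
     (\<forall>v \<in> carrier_vec (dim_row A). v \<noteq> 0\<^sub>v (dim_row A) \<longrightarrow> 0 < Re ((A *\<^sub>v v) \<bullet>c v))"

(* Meant for Hermitian matrices of positive dimension only: their spectrum is
   real, finite and nonempty, so restricting to real x loses nothing and the
   minimum is attained. *)
definition smallest_eigenvalue :: "complex mat \<Rightarrow> real" where
  "smallest_eigenvalue A = Min {x :: real. eigenvalue A (complex_of_real x)}"

end

theory Submission
  imports Defs
begin

text \<open>
  The matrix is the Cauchy matrix \<open>C = (1 / (x j + y k))\<close> with \<open>x j = \<alpha> j\<close>, \<open>y k = cnj (\<alpha> k) + 1\<close>, and
  the Gram matrix of the powers \<open>t \<mapsto> t powr \<alpha> j\<close> on \<open>[0, 1]\<close>. Let \<open>A\<close> be the lower triangular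
  matrix of coefficients of the Muentz-Legendre polynomials in these powers. Lagrange
  interpolation gives an explicit upper triangular \<open>A C\<close>, hence \<open>det C\<close>; with \<open>B\<close> the transpose of
  the matrix obtained from \<open>A\<close> by exchanging \<open>x\<close> and \<open>y\<close>, the product \<open>A C B\<close> is both upper and
  lower triangular, so it is the diagonal matrix \<open>E\<^sup>-\<^sup>1\<close> with \<open>E = diag (x m + y m)\<close>, and \<open>B E A\<close> inverts \<open>C\<close>.
  An eigenvalue of \<open>C\<close> is bounded below by the reciprocal of the largest absolute row sum of that inverse.
\<close>

section \<open>Lagrange interpolation\<close>

text \<open>Both sides have degree below \<open>card I\<close> and agree at the
  \<open>card I\<close> nodes: at \<open>x l\<close> every summand with i \<noteq> l contains the
  vanishing factor of the node \<open>x l\<close>. The denominators are kept in the scalars because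
  these become the values of \<open>cauchy_coeff\<close>.\<close>

lemma lagrange_interpolation:
  fixes x :: "'i \<Rightarrow> 'a::field" and p :: "'a poly"
  assumes "finite I" "inj_on x I" "degree p < card I"
  shows "p = (\<Sum>i\<in>I. Polynomial.smult (poly p (x i) / (\<Prod>j\<in>I - {i}. x i - x j)) (\<Prod>j\<in>I - {i}. [:- x j, 1:]))"
    (is "p = ?q")
proof (rule poly_eqI_degree)
  show "poly p z = poly ?q z" if "z \<in> x ` I" for z
  proof -
    obtain l where l: "l \<in> I" "z = x l" using \<open>z \<in> x ` I\<close> by blast
    have "poly ?q z = (\<Sum>i\<in>I. if i = l then poly p (x l) else 0)"
      unfolding poly_sum
    proof (rule sum.cong[OF refl])
      fix i assume i: "i \<in> I"
      show "poly (Polynomial.smult (poly p (x i) / (\<Prod>j\<in>I - {i}. x i - x j)) (\<Prod>j\<in>I - {i}. [:- x j, 1:])) z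
          = (if i = l then poly p (x l) else 0)"
      proof (cases "i = l")
        case True
        have "(\<Prod>j\<in>I - {l}. x l - x j) \<noteq> 0"
          using assms l by (auto simp: prod_zero_iff inj_on_def)
        then show ?thesis using True l by (simp add: poly_prod)
      next
        case False
        have "(\<Prod>j\<in>I - {i}. z - x j) = 0"
          using assms(1) l False by (auto simp: prod_zero_iff)
        then show ?thesis using False by (simp add: poly_prod)
      qed
    qed
    also have "\<dots> = poly p z" using assms(1) l by simp
    finally show ?thesis by simp
  qed
  show "degree p < card (x ` I)" using assms by (simp add: card_image)
  \<comment> \<open>The subtraction does not truncate: \<open>degree p < card I\<close> forces
    \<open>card I\<close> to be positive, so this bound is strict below
    \<open>card I\<close>.\<close>
  have "degree ?q \<le> card I - 1"
  proof (rule degree_sum_le)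
    fix i assume i: "i \<in> I"
    have "degree (\<Prod>j\<in>I - {i}. [:- x j, 1:]) \<le> (\<Sum>j\<in>I - {i}. degree [:- x j, 1:])"
      using degree_prod_sum_le[of "I - {i}" "\<lambda>j. [:- x j, 1:]"] assms(1) by (simp add: o_def)
    also have "\<dots> = card I - 1" using i assms(1) by simp
    finally show "degree (Polynomial.smult (poly p (x i) / (\<Prod>j\<in>I - {i}. x i - x j)) (\<Prod>j\<in>I - {i}. [:- x j, 1:]))
        \<le> card I - 1"
      by (rule order_trans[OF degree_smult_le])
  qed (use assms in auto)
  then show "degree ?q < card (x ` I)" using assms by (simp add: card_image)
qed

section \<open>Cauchy matrices: triangular factor and determinant\<close>

definition cauchy_mat :: "nat \<Rightarrow> (nat \<Rightarrow> 'a::field) \<Rightarrow> (nat \<Rightarrow> 'a) \<Rightarrow> 'a mat" where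
  "cauchy_mat N x y = mat N N (\<lambda>(j, k). 1 / (x j + y k))"

text \<open>For distinct nodes and j \<le> m, this is the residue at \<open>t = x j\<close> of
  \<open>(\<Prod>r<m. t + y r) / (\<Prod>r\<le>m. t - x r)\<close>. With
  \<open>y k = cnj (x k) + 1\<close> it is the coefficient of \<open>t powr x j\<close> in the
  \<open>m\<close>-th Muentz-Legendre polynomial.\<close>

definition cauchy_coeff :: "(nat \<Rightarrow> 'a::field) \<Rightarrow> (nat \<Rightarrow> 'a) \<Rightarrow> nat \<Rightarrow> nat \<Rightarrow> 'a" where
  "cauchy_coeff x y m j = (\<Prod>r<m. x j + y r) / (\<Prod>r\<in>{0..m} - {j}. x j - x r)"

definition cauchy_coeff_mat :: "nat \<Rightarrow> (nat \<Rightarrow> 'a::field) \<Rightarrow> (nat \<Rightarrow> 'a) \<Rightarrow> 'a mat" where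
  "cauchy_coeff_mat N x y = mat N N (\<lambda>(m, j). if j \<le> m then cauchy_coeff x y m j else 0)"

lemma cauchy_mat_carrier [simp]: "cauchy_mat N x y \<in> carrier_mat N N"
  and cauchy_coeff_mat_carrier [simp]: "cauchy_coeff_mat N x y \<in> carrier_mat N N"
  by (simp_all add: cauchy_mat_def cauchy_coeff_mat_def)

lemma transpose_cauchy_mat: "transpose_mat (cauchy_mat N x y) = cauchy_mat N y x"
  by (rule eq_matI) (auto simp: cauchy_mat_def add.commute)

text \<open>Partial fraction expansion of \<open>(\<Prod>r<m. t + y r) / (\<Prod>r\<le>m. t - x r)\<close>, read off at \<open>t = - z\<close>.\<close>

lemma cauchy_coeff_sum:
  assumes inj: "inj_on x {0..m}" and nz: "\<And>j. j \<le> m \<Longrightarrow> x j + z \<noteq> 0"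
  shows "(\<Sum>j = 0..m. cauchy_coeff x y m j * (1 / (x j + z)))
       = (\<Prod>r<m. z - y r) / (\<Prod>r\<in>{0..m}. z + x r)"
proof -
  define p where "p = (\<Prod>r<m. [:y r, 1:])"
  have pp: "poly p t = (\<Prod>r<m. t + y r)" for t
    by (simp add: p_def poly_prod add.commute)
  have "degree p \<le> (\<Sum>r<m. degree [:y r, 1:])"
    using degree_prod_sum_le[of "{..<m}" "\<lambda>r. [:y r, 1:]"] by (simp add: p_def o_def)
  then have "degree p < card {0..m}" by simp
  from lagrange_interpolation[OF _ inj this]
  have "poly p (- z) = poly (\<Sum>i\<in>{0..m}. Polynomial.smult (poly p (x i) / (\<Prod>j\<in>{0..m} - {i}. x i - x j))
      (\<Prod>j\<in>{0..m} - {i}. [:- x j, 1:])) (- z)"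
    by simp
  also have "\<dots> = (\<Sum>i = 0..m. cauchy_coeff x y m i * (\<Prod>j\<in>{0..m} - {i}. - z - x j))"
    by (simp add: poly_sum poly_prod pp cauchy_coeff_def minus_diff_commute)
  \<comment> \<open>Each product without the factor \<open>i\<close> is the full product divided by
    \<open>- z - x i = - (x i + z)\<close>; the full product then leaves the sum as a common
    factor.\<close>
  also have "\<dots> = (\<Sum>i = 0..m. cauchy_coeff x y m i * (1 / (x i + z)) * (- (\<Prod>j\<in>{0..m}. - z - x j)))"
  proof (rule sum.cong[OF refl])
    fix i assume i: "i \<in> {0..m}"
    have "(\<Prod>j\<in>{0..m}. - z - x j) = (- z - x i) * (\<Prod>j\<in>{0..m} - {i}. - z - x j)"
      using i by (intro prod.remove) auto
    then have "(\<Prod>j\<in>{0..m}. - z - x j) = - ((x i + z) * (\<Prod>j\<in>{0..m} - {i}. - z - x j))"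
      by (simp add: algebra_simps)
    then have "(\<Prod>j\<in>{0..m} - {i}. - z - x j) = 1 / (x i + z) * (- (\<Prod>j\<in>{0..m}. - z - x j))"
      using nz[of i] i by simp
    then show "cauchy_coeff x y m i * (\<Prod>j\<in>{0..m} - {i}. - z - x j)
        = cauchy_coeff x y m i * (1 / (x i + z)) * (- (\<Prod>j\<in>{0..m}. - z - x j))"
      by (simp add: mult.assoc)
  qed
  also have "\<dots> = (\<Sum>i = 0..m. cauchy_coeff x y m i * (1 / (x i + z))) * (- (\<Prod>j\<in>{0..m}. - z - x j))"
    by (simp only: sum_distrib_right)
  finally have *: "(\<Prod>r<m. - z + y r) = (\<Sum>i = 0..m. cauchy_coeff x y m i * (1 / (x i + z))) * (- (\<Prod>j\<in>{0..m}. - z - x j))"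
    by (simp only: pp)
  \<comment> \<open>Sign count: this product has \<open>m + 1\<close> factors, the numerator has
    \<open>m\<close>, and the extra minus sign in front compensates, so \<open>(- 1) ^ m\<close>
    cancels on both sides.\<close>
  have "(\<Prod>j\<in>{0..m}. - z - x j) = (\<Prod>j\<in>{0..m}. - 1 * (z + x j))"
    by (rule prod.cong) auto
  also have "\<dots> = (- 1) ^ Suc m * (\<Prod>j\<in>{0..m}. z + x j)"
    by (subst prod.distrib) simp
  finally have D: "- (\<Prod>j\<in>{0..m}. - z - x j) = (- 1) ^ m * (\<Prod>j\<in>{0..m}. z + x j)" by simp
  have "(\<Prod>r<m. - z + y r) = (\<Prod>r<m. - 1 * (z - y r))"
    by (rule prod.cong) auto
  also have "\<dots> = (- 1) ^ m * (\<Prod>r<m. z - y r)"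
    by (subst prod.distrib) simp
  finally have "(- 1) ^ m * (\<Prod>r<m. z - y r)
      = (- 1) ^ m * ((\<Sum>i = 0..m. cauchy_coeff x y m i * (1 / (x i + z))) * (\<Prod>j\<in>{0..m}. z + x j))"
    unfolding * D by (simp only: mult_ac)
  then have "(\<Prod>r<m. z - y r)
      = (\<Sum>i = 0..m. cauchy_coeff x y m i * (1 / (x i + z))) * (\<Prod>j\<in>{0..m}. z + x j)"
    by simp
  moreover have "(\<Prod>j\<in>{0..m}. z + x j) \<noteq> 0"
    using nz by (auto simp: prod_zero_iff add.commute)
  ultimately show ?thesis by (metis nonzero_mult_div_cancel_right)
qed

text \<open>Each entry is the partial fraction sum at \<open>z = y k\<close>. The result is upper
  triangular: for \<open>k < m\<close> the numerator contains the zero factor r = k.\<close>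

lemma cauchy_coeff_mat_mult_cauchy_mat:
  assumes inj: "inj_on x {..<N}" and nz: "\<And>j k. j < N \<Longrightarrow> k < N \<Longrightarrow> x j + y k \<noteq> 0"
  shows "cauchy_coeff_mat N x y * cauchy_mat N x y
       = mat N N (\<lambda>(m, k). (\<Prod>r<m. y k - y r) / (\<Prod>r\<in>{0..m}. y k + x r))"
proof (rule eq_matI)
  fix m k assume "m < dim_row (mat N N (\<lambda>(m, k). (\<Prod>r<m. y k - y r) / (\<Prod>r\<in>{0..m}. y k + x r)))"
    and "k < dim_col (mat N N (\<lambda>(m, k). (\<Prod>r<m. y k - y r) / (\<Prod>r\<in>{0..m}. y k + x r)))"
  then have m: "m < N" and k: "k < N" by auto
  have "(cauchy_coeff_mat N x y * cauchy_mat N x y) $$ (m, k)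
      = (\<Sum>j = 0..<N. (if j \<le> m then cauchy_coeff x y m j else 0) * (1 / (x j + y k)))"
    using m k by (simp add: cauchy_coeff_mat_def cauchy_mat_def scalar_prod_def)
  also have "\<dots> = (\<Sum>j = 0..m. cauchy_coeff x y m j * (1 / (x j + y k)))"
    using m by (intro sum.mono_neutral_cong_right) auto
  also have "\<dots> = (\<Prod>r<m. y k - y r) / (\<Prod>r\<in>{0..m}. y k + x r)"
  proof (rule cauchy_coeff_sum)
    show "inj_on x {0..m}" using inj m by (auto intro: inj_on_subset)
  qed (use nz m k in auto)
  finally show "(cauchy_coeff_mat N x y * cauchy_mat N x y) $$ (m, k)
      = mat N N (\<lambda>(m, k). (\<Prod>r<m. y k - y r) / (\<Prod>r\<in>{0..m}. y k + x r)) $$ (m, k)"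
    using m k by simp
qed (auto simp: cauchy_coeff_mat_def cauchy_mat_def)

lemma prod_atLeast0AtMost_split: "(\<Prod>r\<in>{0..m::nat}. f r) = f m * (\<Prod>r<m. f r)"
  by (simp add: atLeast0AtMost lessThan_Suc_atMost[symmetric] mult.commute)

lemma cauchy_coeff_diag: "cauchy_coeff x y m m = (\<Prod>r<m. x m + y r) / (\<Prod>r<m. x m - x r)"
proof -
  have "{0..m} - {m} = {..<m}" by auto
  then show ?thesis by (simp add: cauchy_coeff_def)
qed

text \<open>Take determinants in \<open>A C = U\<close>. Both \<open>A\<close> and \<open>U\<close>
  are triangular, so theirs are products of diagonal entries, and those of \<open>A\<close> are
  nonzero.\<close>

theorem det_cauchy_mat:
  assumes inj: "inj_on x {..<N}" and nz: "\<And>j k. j < N \<Longrightarrow> k < N \<Longrightarrow> x j + y k \<noteq> 0"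
  shows "det (cauchy_mat N x y)
       = (\<Prod>m<N. (\<Prod>r<m. (x m - x r) * (y m - y r)) / ((x m + y m) * (\<Prod>r<m. (x m + y r) * (x r + y m))))"
proof -
  let ?A = "cauchy_coeff_mat N x y"
  let ?U = "mat N N (\<lambda>(m, k). (\<Prod>r<m. y k - y r) / (\<Prod>r\<in>{0..m}. y k + x r))"
  have "det ?A = (\<Prod>m<N. cauchy_coeff x y m m)"
    by (subst det_lower_triangular[of N])
       (auto simp: cauchy_coeff_mat_def prod_list_diag_prod lessThan_atLeast0 intro!: prod.cong)
  moreover have "upper_triangular ?U"
    by (auto simp: upper_triangular_def prod_zero_iff)
  then have "det ?U = (\<Prod>m<N. (\<Prod>r<m. y m - y r) / (\<Prod>r\<in>{0..m}. y m + x r))"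
    by (subst det_upper_triangular[OF \<open>upper_triangular ?U\<close>, of N])
       (auto simp: prod_list_diag_prod lessThan_atLeast0 intro!: prod.cong)
  moreover have "det ?A * det (cauchy_mat N x y) = det ?U"
    using cauchy_coeff_mat_mult_cauchy_mat[OF inj nz] det_mult[of ?A N "cauchy_mat N x y"] by simp
  ultimately have "(\<Prod>m<N. cauchy_coeff x y m m) * det (cauchy_mat N x y)
      = (\<Prod>m<N. (\<Prod>r<m. y m - y r) / (\<Prod>r\<in>{0..m}. y m + x r))" by simp
  moreover have c: "cauchy_coeff x y m m \<noteq> 0" if "m < N" for m
    using that inj nz by (auto simp: cauchy_coeff_diag prod_zero_iff dest: inj_onD)
  then have "(\<Prod>m<N. cauchy_coeff x y m m) \<noteq> 0" by (simp add: prod_zero_iff)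
  ultimately have "det (cauchy_mat N x y)
      = (\<Prod>m<N. (\<Prod>r<m. y m - y r) / (\<Prod>r\<in>{0..m}. y m + x r)) / (\<Prod>m<N. cauchy_coeff x y m m)"
    by (metis nonzero_mult_div_cancel_left)
  also have "\<dots> = (\<Prod>m<N. (\<Prod>r<m. y m - y r) / (\<Prod>r\<in>{0..m}. y m + x r) / cauchy_coeff x y m m)"
    by (simp add: prod_dividef)
  also have "\<dots> = (\<Prod>m<N. (\<Prod>r<m. (x m - x r) * (y m - y r)) / ((x m + y m) * (\<Prod>r<m. (x m + y r) * (x r + y m))))"
    by (intro prod.cong refl)
       (simp add: cauchy_coeff_diag prod_atLeast0AtMost_split prod.distrib add.commute mult_ac)
  finally show ?thesis .
qed

section \<open>Diagonalization and inverse of a Cauchy matrix\<close>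

lemma cauchy_mat_diagonalization:
  assumes injx: "inj_on x {..<N}" and injy: "inj_on y {..<N}"
    and nz: "\<And>j k. j < N \<Longrightarrow> k < N \<Longrightarrow> x j + y k \<noteq> 0"
  shows "cauchy_coeff_mat N x y * cauchy_mat N x y * transpose_mat (cauchy_coeff_mat N y x)
       = mat N N (\<lambda>(j, k). if j = k then 1 / (x j + y j) else 0)"
proof -
  let ?A = "cauchy_coeff_mat N x y" and ?B = "transpose_mat (cauchy_coeff_mat N y x)"
  let ?C = "cauchy_mat N x y"
  let ?U = "\<lambda>x y. mat N N (\<lambda>(m, k). (\<Prod>r<m. y k - y r) / (\<Prod>r\<in>{0..m}. y k + x r))"
  let ?D = "mat N N (\<lambda>(j, k). if j = k then 1 / (x j + y j) else 0)"
  have B: "?B \<in> carrier_mat N N" by simp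
  have AC: "?A * ?C = ?U x y"
    by (rule cauchy_coeff_mat_mult_cauchy_mat[OF injx nz])
  \<comment> \<open>Transposing a Cauchy matrix exchanges \<open>x\<close> and \<open>y\<close>, so
    the product from the right is an instance of the product from the left.\<close>
  have "transpose_mat (?C * ?B) = cauchy_coeff_mat N y x * cauchy_mat N y x"
    by (subst transpose_mult[of _ N N _ N]) (auto simp: transpose_cauchy_mat)
  also have "\<dots> = ?U y x"
    using nz by (intro cauchy_coeff_mat_mult_cauchy_mat[OF injy]) (auto simp: add.commute)
  finally have CB: "?C * ?B = transpose_mat (?U y x)"
    by (metis transpose_transpose)
  show ?thesis
  proof (rule eq_matI)
    fix m k assume "m < dim_row ?D" "k < dim_col ?D"
    then have m: "m < N" and k: "k < N" by auto
    have U0: "(\<Prod>r<m. y l - y r) = 0" if "l < m" for l m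
      using that by (auto simp: prod_zero_iff)
    have U0': "(\<Prod>r<m. x l - x r) = 0" if "l < m" for l m
      using that by (auto simp: prod_zero_iff)
    \<comment> \<open>Two readings of one entry: \<open>(A C) B\<close> is a product of upper
      triangular matrices and vanishes for \<open>k < m\<close>; \<open>A (C B)\<close> is a product
      of lower triangular ones and vanishes for \<open>m < k\<close>.\<close>
    have e1: "(?A * ?C * ?B) $$ (m, k)
        = (\<Sum>j = 0..<N. (\<Prod>r<m. y j - y r) / (\<Prod>r\<in>{0..m}. y j + x r) * (if j \<le> k then cauchy_coeff y x k j else 0))"
      unfolding AC using m k by (simp add: cauchy_coeff_mat_def scalar_prod_def)
    have e2: "(?A * ?C * ?B) $$ (m, k)
        = (\<Sum>j = 0..<N. (if j \<le> m then cauchy_coeff x y m j else 0) * ((\<Prod>r<k. x j - x r) / (\<Prod>r\<in>{0..k}. x j + y r)))"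
      unfolding assoc_mult_mat[OF cauchy_coeff_mat_carrier cauchy_mat_carrier B] CB
      using m k by (simp add: cauchy_coeff_mat_def scalar_prod_def)
    consider "k < m" | "m < k" | "m = k" by linarith
    then show "(?A * ?C * ?B) $$ (m, k) = ?D $$ (m, k)"
    proof cases
      case 1
      have "(?A * ?C * ?B) $$ (m, k) = 0"
        unfolding e1 using 1 by (intro sum.neutral) (auto simp: U0)
      then show ?thesis using 1 m k by simp
    next
      case 2
      have "(?A * ?C * ?B) $$ (m, k) = 0"
        unfolding e2 using 2 by (intro sum.neutral) (auto simp: U0')
      then show ?thesis using 2 m k by simp
    next
      case 3
      have "(?A * ?C * ?B) $$ (m, k)
          = (\<Sum>j = 0..<N. if j = m then (\<Prod>r<m. y m - y r) / (\<Prod>r\<in>{0..m}. y m + x r) * cauchy_coeff y x m m else 0)"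
        unfolding e1[unfolded 3[symmetric]] 3[symmetric] by (intro sum.cong refl) (auto simp: U0 not_less)
      also have "\<dots> = (\<Prod>r<m. y m - y r) / (\<Prod>r\<in>{0..m}. y m + x r) * cauchy_coeff y x m m"
        using m by simp
      \<comment> \<open>All factors with \<open>r < m\<close> cancel between the two quotients; only
        the factor r = m of the denominator survives.\<close>
      also have "\<dots> = 1 / (x m + y m)"
      proof -
        have "(\<Prod>r<m. y m - y r) \<noteq> 0" using injy m by (auto simp: prod_zero_iff dest: inj_onD)
        moreover have "(\<Prod>r<m. y m + x r) \<noteq> 0" using nz m by (auto simp: prod_zero_iff add.commute)
        ultimately show ?thesis
          by (simp add: cauchy_coeff_diag prod_atLeast0AtMost_split add.commute)
      qed
      finally show ?thesis using 3 m by simp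
    qed
  qed (auto simp: cauchy_coeff_mat_def)
qed

text \<open>The entries of \<open>B E A\<close>. The sum starts at \<open>max j k\<close> because
  the triangular factors vanish unless j \<le> m and k \<le> m.\<close>

definition cauchy_inv :: "nat \<Rightarrow> (nat \<Rightarrow> 'a::field) \<Rightarrow> (nat \<Rightarrow> 'a) \<Rightarrow> 'a mat" where
  "cauchy_inv N x y = mat N N (\<lambda>(j, k).
     \<Sum>m = max j k..<N. (x m + y m) * cauchy_coeff y x m j * cauchy_coeff x y m k)"

text \<open>Diagonalization gives \<open>A (C B E) = 1\<close>. A one-sided inverse of a square
  matrix is two-sided, so \<open>(C B E) A = 1\<close>, which reassociates to
  \<open>C (B E A) = 1\<close>.\<close>

theorem cauchy_mat_inverse:
  assumes injx: "inj_on x {..<N}" and injy: "inj_on y {..<N}"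
    and nz: "\<And>j k. j < N \<Longrightarrow> k < N \<Longrightarrow> x j + y k \<noteq> 0"
  shows "cauchy_mat N x y * cauchy_inv N x y = 1\<^sub>m N" "cauchy_inv N x y * cauchy_mat N x y = 1\<^sub>m N"
proof -
  let ?A = "cauchy_coeff_mat N x y" and ?B = "transpose_mat (cauchy_coeff_mat N y x)"
  let ?C = "cauchy_mat N x y" and ?G = "cauchy_inv N x y"
  let ?D = "mat N N (\<lambda>(j, k). if j = k then 1 / (x j + y j) else 0)"
  define E where "E = mat N N (\<lambda>(j, k). if j = k then x j + y j else 0)"
  have A: "?A \<in> carrier_mat N N" and B: "?B \<in> carrier_mat N N" and C: "?C \<in> carrier_mat N N"
    and E: "E \<in> carrier_mat N N" and G: "?G \<in> carrier_mat N N"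
    by (simp_all add: E_def cauchy_inv_def)
  have BE: "?B * E = mat N N (\<lambda>(j, m). ?B $$ (j, m) * (x m + y m))"
    by (rule eq_matI) (auto simp: E_def scalar_prod_def cauchy_coeff_mat_def if_distrib[of "\<lambda>t. _ * t"] cong: if_cong)
  have BEA: "?B * E * ?A = ?G"
  proof (rule eq_matI)
    fix j k assume "j < dim_row ?G" "k < dim_col ?G"
    then have j: "j < N" and k: "k < N" using G by auto
    have "(?B * E * ?A) $$ (j, k) = (\<Sum>m = 0..<N. (if j \<le> m then cauchy_coeff y x m j else 0) * (x m + y m)
         * (if k \<le> m then cauchy_coeff x y m k else 0))"
      unfolding BE using j k by (simp add: scalar_prod_def cauchy_coeff_mat_def)
    also have "\<dots> = (\<Sum>m = max j k..<N. (x m + y m) * cauchy_coeff y x m j * cauchy_coeff x y m k)"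
      by (intro sum.mono_neutral_cong_right) auto
    finally show "(?B * E * ?A) $$ (j, k) = ?G $$ (j, k)"
      using j k by (simp add: cauchy_inv_def)
  qed (auto simp: cauchy_coeff_mat_def cauchy_inv_def)
  have diag: "?A * ?C * ?B = ?D"
    by (rule cauchy_mat_diagonalization[OF injx injy nz])
  have "?A * ?C * ?B * E = 1\<^sub>m N"
    unfolding diag
    by (rule eq_matI)
       (use nz in \<open>auto simp: E_def scalar_prod_def if_distrib[of "\<lambda>t. _ * t"] if_distrib[of "\<lambda>t. t * _"] cong: if_cong\<close>)
  then have "?A * (?C * ?B * E) = 1\<^sub>m N"
    using A B C E by (simp add: assoc_mult_mat[of _ N N _ N _ N])
  then have "?C * ?B * E * ?A = 1\<^sub>m N"
    using mat_mult_left_right_inverse[OF A] B C E by (meson mult_carrier_mat)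
  then have "?C * (?B * E * ?A) = 1\<^sub>m N"
    using A B C E by (simp add: assoc_mult_mat[of _ N N _ N _ N] del: transpose_carrier_mat)
  then show CG: "?C * ?G = 1\<^sub>m N" by (simp only: BEA)
  show "?G * ?C = 1\<^sub>m N" by (rule mat_mult_left_right_inverse[OF C G CG])
qed

section \<open>Positive definite matrices and their eigenvalues\<close>

lemma mat_adjoint_index:
  assumes "A \<in> carrier_mat N N" "i < N" "j < N"
  shows "mat_adjoint A $$ (i, j) = conjugate (A $$ (j, i))"
  using assms by (auto simp: mat_adjoint_def mat_of_rows_def)

lemma cscalar_prod_self:
  fixes v :: "complex vec"
  shows "v \<bullet>c v = complex_of_real (\<Sum>i<dim_vec v. (cmod (v $ i))\<^sup>2)"
  by (simp add: scalar_prod_def lessThan_atLeast0 complex_norm_square del: of_real_power)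

text \<open>Conjugation exchanges the two summation indices. Since \<open>positive_definite\<close>
  bounds only the real part of the form, this is what makes eigenvalues real.\<close>

lemma hermitian_form_real:
  fixes A :: "complex mat"
  assumes A: "A \<in> carrier_mat N N" and adj: "mat_adjoint A = A" and v: "v \<in> carrier_vec N"
  shows "(A *\<^sub>v v) \<bullet>c v \<in> \<real>"
proof -
  have form: "(A *\<^sub>v v) \<bullet>c v = (\<Sum>i<N. \<Sum>j<N. A $$ (i, j) * v $ j * cnj (v $ i))"
    using A v by (simp add: scalar_prod_def lessThan_atLeast0 sum_distrib_right)
  have h: "cnj (A $$ (i, j)) = A $$ (j, i)" if "i < N" "j < N" for i j
    using mat_adjoint_index[OF A that(2,1)] adj by simp
  have "cnj ((A *\<^sub>v v) \<bullet>c v) = (\<Sum>i<N. \<Sum>j<N. A $$ (j, i) * v $ i * cnj (v $ j))"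
    unfolding form cnj_sum by (intro sum.cong refl) (simp add: h mult_ac)
  also have "\<dots> = (A *\<^sub>v v) \<bullet>c v" unfolding form by (rule sum.swap)
  finally show ?thesis by (simp add: Reals_cnj_iff)
qed

text \<open>At an eigenvector the form equals \<open>c\<close> times the squared norm
  \<open>s\<close>, so it transfers both its reality and its positivity to \<open>c\<close>.\<close>

lemma positive_definite_eigenvalue:
  assumes pd: "positive_definite A" and ev: "eigenvalue A c"
  shows "c \<in> \<real>" "0 < Re c"
proof -
  define N where "N = dim_row A"
  have A: "A \<in> carrier_mat N N" and adj: "mat_adjoint A = A"
    using pd by (auto simp: positive_definite_def N_def)
  obtain v where v: "v \<in> carrier_vec N" "v \<noteq> 0\<^sub>v N" and Av: "A *\<^sub>v v = c \<cdot>\<^sub>v v"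
    using ev by (auto simp: eigenvalue_def eigenvector_def N_def)
  define s where "s = (\<Sum>i<N. (cmod (v $ i))\<^sup>2)"
  have form: "(A *\<^sub>v v) \<bullet>c v = c * complex_of_real s"
    unfolding Av using v by (simp add: s_def cscalar_prod_self del: of_real_sum of_real_power)
  have "0 < Re ((A *\<^sub>v v) \<bullet>c v)"
    using pd v by (auto simp: positive_definite_def N_def)
  then have pos: "0 < Re c * s" unfolding form by simp
  moreover have "s \<ge> 0" by (simp add: s_def sum_nonneg)
  ultimately show "0 < Re c" by (simp add: zero_less_mult_iff)
  have "c * complex_of_real s \<in> \<real>" using hermitian_form_real[OF A adj v(1)] form by simp
  moreover have "s \<noteq> 0" using pos by auto
  ultimately show "c \<in> \<real>" by (simp add: complex_is_Real_iff)
qed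

text \<open>The form vanishes at a kernel vector. For the Gram matrix this excludes repeated
  exponents.\<close>

lemma positive_definite_det_nonzero:
  assumes "positive_definite A"
  shows "det A \<noteq> 0"
proof
  assume "det A = 0"
  moreover have "A \<in> carrier_mat (dim_row A) (dim_row A)"
    using assms by (auto simp: positive_definite_def)
  ultimately obtain v where "v \<in> carrier_vec (dim_row A)" "v \<noteq> 0\<^sub>v (dim_row A)" "A *\<^sub>v v = 0\<^sub>v (dim_row A)"
    using det_0_iff_vec_prod_zero by blast
  with assms show False by (auto simp: positive_definite_def)
qed

lemma positive_definite_diag_pos:
  assumes pd: "positive_definite A" and i: "i < dim_row A"
  shows "0 < Re (A $$ (i, i))"
proof -
  define N where "N = dim_row A"
  let ?e = "unit_vec N i :: complex vec"
  have A: "A \<in> carrier_mat N N" using pd by (auto simp: positive_definite_def N_def)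
  have iN: "i < N" using i by (simp add: N_def)
  have "conjugate ?e = ?e" by (rule eq_vecI) (auto simp: unit_vec_def)
  then have "(A *\<^sub>v ?e) \<bullet>c ?e = (A *\<^sub>v ?e) $ i" using iN by simp
  also have "\<dots> = row A i \<bullet> ?e" using A iN by (intro index_mult_mat_vec) simp
  also have "\<dots> = A $$ (i, i)" using A iN by simp
  finally have "(A *\<^sub>v ?e) \<bullet>c ?e = A $$ (i, i)" .
  moreover have "?e \<noteq> 0\<^sub>v N" using iN by simp
  moreover have "0 < Re ((A *\<^sub>v ?e) \<bullet>c ?e)" if "?e \<noteq> 0\<^sub>v N"
    using pd that unfolding positive_definite_def N_def[symmetric] by simp
  ultimately show ?thesis by simp
qed

text \<open>The maximum row sum bounds the spectral radius, applied to the inverse \<open>B\<close>.\<close>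

lemma eigenvalue_ge_inverse_row_sum:
  fixes A B :: "complex mat"
  assumes A: "A \<in> carrier_mat N N" and B: "B \<in> carrier_mat N N" and BA: "B * A = 1\<^sub>m N"
    and rows: "\<And>i. i < N \<Longrightarrow> (\<Sum>j<N. cmod (B $$ (i, j))) \<le> S"
    and ev: "eigenvalue A c"
  shows "1 \<le> cmod c * S"
proof -
  obtain v where v: "v \<in> carrier_vec N" "v \<noteq> 0\<^sub>v N" and Av: "A *\<^sub>v v = c \<cdot>\<^sub>v v"
    using ev A by (auto simp: eigenvalue_def eigenvector_def)
  have "v = (B * A) *\<^sub>v v" using BA v by simp
  also have "\<dots> = B *\<^sub>v (c \<cdot>\<^sub>v v)" using A B v Av by simp
  also have "\<dots> = c \<cdot>\<^sub>v (B *\<^sub>v v)" using B v by (simp add: mult_mat_vec)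
  finally have vB: "v = c \<cdot>\<^sub>v (B *\<^sub>v v)" .
  obtain k where k: "k < N" "v $ k \<noteq> 0"
    using v by (metis carrier_vecD dim_vec eq_vecI index_zero_vec(1) zero_carrier_vec)
  \<comment> \<open>The argument compares both sides in a row \<open>i\<close> where the modulus of
    \<open>v\<close> is maximal: \<open>b\<close> then dominates every entry and, being positive,
    cancels.\<close>
  define b where "b = Max ((\<lambda>i. cmod (v $ i)) ` {..<N})"
  have "b \<in> (\<lambda>i. cmod (v $ i)) ` {..<N}" unfolding b_def using k by (intro Max_in) auto
  then obtain i where i: "i < N" "cmod (v $ i) = b" by auto
  have le: "cmod (v $ j) \<le> b" if "j < N" for j unfolding b_def using that by simp
  have b: "b > 0" using le[OF k(1)] k(2) by (smt (verit) zero_less_norm_iff)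
  have "v $ i = c * (\<Sum>j<N. B $$ (i, j) * v $ j)"
    using arg_cong[OF vB, of "\<lambda>w. w $ i"] i B v by (simp add: scalar_prod_def lessThan_atLeast0)
  then have "b \<le> cmod c * cmod (\<Sum>j<N. B $$ (i, j) * v $ j)" using i by (metis norm_mult order_refl)
  also have "\<dots> \<le> cmod c * (\<Sum>j<N. cmod (B $$ (i, j)) * b)"
    by (intro mult_left_mono sum_norm_le) (auto simp: norm_mult intro!: mult_left_mono le)
  also have "\<dots> = cmod c * (\<Sum>j<N. cmod (B $$ (i, j))) * b"
    by (simp add: sum_distrib_right mult.assoc)
  also have "\<dots> \<le> cmod c * S * b"
    using rows[OF i(1)] b by (intro mult_right_mono mult_left_mono) auto
  finally show ?thesis using b by simp
qed

text \<open>\<open>Min\<close> is meaningful only on a finite nonempty set. The spectrum is finite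
  and nonempty, and positive definiteness makes its members real.\<close>

lemma smallest_eigenvalue_mem:
  assumes pd: "positive_definite A" and "dim_row A > 0"
  shows "eigenvalue A (complex_of_real (smallest_eigenvalue A))"
proof -
  have A: "A \<in> carrier_mat (dim_row A) (dim_row A)"
    using pd by (auto simp: positive_definite_def)
  let ?X = "{x :: real. eigenvalue A (complex_of_real x)}"
  have "complex_of_real ` ?X \<subseteq> spectrum A" by (auto simp: spectrum_def)
  then have "finite (complex_of_real ` ?X)"
    using card_finite_spectrum(1)[OF A] finite_subset by blast
  then have "finite ?X" by (rule finite_imageD) (simp add: inj_on_def)
  moreover obtain c where c: "eigenvalue A c"
    using spectrum_non_empty[OF A assms(2)] by (auto simp: spectrum_def)
  have "complex_of_real (Re c) = c" using positive_definite_eigenvalue(1)[OF pd c] by simp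
  then have "?X \<noteq> {}" using c by (metis empty_Collect_eq)
  ultimately have "smallest_eigenvalue A \<in> ?X" unfolding smallest_eigenvalue_def by (rule Min_in)
  then show ?thesis by simp
qed

section \<open>Determinant and inverse of the Gram matrix\<close>

lemma gram_mat_eq_cauchy_mat: "gram_mat n \<alpha> = cauchy_mat (Suc n) \<alpha> (\<lambda>k. cnj (\<alpha> k) + 1)"
  by (simp add: gram_mat_def cauchy_mat_def add.assoc)

lemma add_cnj_add_1: "a + (cnj a + 1) = complex_of_real (1 + 2 * Re a)"
  by (simp add: complex_eq_iff)

lemma det_gram_mat_not_inj:
  assumes "\<not> inj_on \<alpha> {..<Suc n}"
  shows "det (gram_mat n \<alpha>) = 0"
proof -
  obtain i j where ij: "i \<le> n" "j \<le> n" "i \<noteq> j" "\<alpha> i = \<alpha> j"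
    using assms unfolding inj_on_def by (metis lessThan_iff less_Suc_eq_le)
  then have "row (gram_mat n \<alpha>) i = row (gram_mat n \<alpha>) j"
    by (intro eq_vecI) (auto simp: gram_mat_def)
  then show ?thesis
    using ij by (intro det_identical_rows[of _ "Suc n" i j]) (auto simp: gram_mat_def)
qed

text \<open>For distinct exponents the factors of the Cauchy determinant pair up with their
  conjugates into squared moduli. For repeated exponents both sides are zero.\<close>

lemma det_gram_mat:
  assumes nz: "\<And>j k. j \<le> n \<Longrightarrow> k \<le> n \<Longrightarrow> \<alpha> j + cnj (\<alpha> k) + 1 \<noteq> 0"
  shows "det (gram_mat n \<alpha>) =
       complex_of_real
         (\<Prod>k\<le>n. (\<Prod>j<k. (cmod (\<alpha> k - \<alpha> j))\<^sup>2) /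
                ((1 + 2 * Re (\<alpha> k)) * (\<Prod>j<k. (cmod (\<alpha> k + cnj (\<alpha> j) + 1))\<^sup>2)))"
proof (cases "inj_on \<alpha> {..<Suc n}")
  case True
  have "det (gram_mat n \<alpha>) = (\<Prod>m<Suc n. (\<Prod>r<m. (\<alpha> m - \<alpha> r) * ((cnj (\<alpha> m) + 1) - (cnj (\<alpha> r) + 1))) /
      ((\<alpha> m + (cnj (\<alpha> m) + 1)) * (\<Prod>r<m. (\<alpha> m + (cnj (\<alpha> r) + 1)) * (\<alpha> r + (cnj (\<alpha> m) + 1)))))"
    unfolding gram_mat_eq_cauchy_mat
    using nz by (intro det_cauchy_mat True) (auto simp: add.assoc[symmetric])
  also have "\<dots> = (\<Prod>k\<le>n. complex_of_real ((\<Prod>j<k. (cmod (\<alpha> k - \<alpha> j))\<^sup>2) /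
                ((1 + 2 * Re (\<alpha> k)) * (\<Prod>j<k. (cmod (\<alpha> k + cnj (\<alpha> j) + 1))\<^sup>2))))"
  proof (rule prod.cong)
    fix m assume "m \<in> {..n}"
    have "(\<Prod>r<m. (\<alpha> m - \<alpha> r) * ((cnj (\<alpha> m) + 1) - (cnj (\<alpha> r) + 1)))
        = complex_of_real (\<Prod>j<m. (cmod (\<alpha> m - \<alpha> j))\<^sup>2)"
      unfolding of_real_prod by (intro prod.cong refl) (simp only: complex_norm_square, simp)
    moreover have "(\<Prod>r<m. (\<alpha> m + (cnj (\<alpha> r) + 1)) * (\<alpha> r + (cnj (\<alpha> m) + 1)))
        = complex_of_real (\<Prod>j<m. (cmod (\<alpha> m + cnj (\<alpha> j) + 1))\<^sup>2)"
      unfolding of_real_prod by (intro prod.cong refl) (simp only: complex_norm_square, simp add: add_ac)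
    ultimately show "(\<Prod>r<m. (\<alpha> m - \<alpha> r) * ((cnj (\<alpha> m) + 1) - (cnj (\<alpha> r) + 1))) /
      ((\<alpha> m + (cnj (\<alpha> m) + 1)) * (\<Prod>r<m. (\<alpha> m + (cnj (\<alpha> r) + 1)) * (\<alpha> r + (cnj (\<alpha> m) + 1))))
      = complex_of_real ((\<Prod>j<m. (cmod (\<alpha> m - \<alpha> j))\<^sup>2) /
                ((1 + 2 * Re (\<alpha> m)) * (\<Prod>j<m. (cmod (\<alpha> m + cnj (\<alpha> j) + 1))\<^sup>2)))"
      unfolding add_cnj_add_1 by (simp only: of_real_divide of_real_mult)
  qed auto
  finally show ?thesis by (simp only: of_real_prod)
next
  case False
  \<comment> \<open>The larger of the two indices is called \<open>i\<close>, so that the zero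
    difference occurs in the product over \<open>j < i\<close>.\<close>
  then obtain i j where ij: "i \<le> n" "j < i" "\<alpha> i = \<alpha> j"
    unfolding inj_on_def by (metis lessThan_iff less_Suc_eq_le linorder_neqE_nat)
  have "det (gram_mat n \<alpha>) = 0" by (rule det_gram_mat_not_inj[OF False])
  moreover have "(\<Prod>j<i. (cmod (\<alpha> i - \<alpha> j))\<^sup>2) = 0"
    using ij by (auto simp: prod_zero_iff)
  then have "(\<Prod>k\<le>n. (\<Prod>j<k. (cmod (\<alpha> k - \<alpha> j))\<^sup>2) /
                ((1 + 2 * Re (\<alpha> k)) * (\<Prod>j<k. (cmod (\<alpha> k + cnj (\<alpha> j) + 1))\<^sup>2))) = 0"
    using ij(1) by (intro prod_zero bexI[of _ i]) (simp_all only: div_0 finite_atMost atMost_iff)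
  ultimately show ?thesis by (simp only: of_real_0)
qed

text \<open>The shift by 1 cancels in the differences of nodes and is only reassociated in the sums.
  Both coefficients in an entry of the inverse thus have moduli of the same form.\<close>

lemma cauchy_coeff_cnj:
  "cauchy_coeff (\<lambda>k. cnj (\<alpha> k) + 1) \<alpha> m j = cnj (cauchy_coeff \<alpha> (\<lambda>k. cnj (\<alpha> k) + 1) m j)"
  by (simp add: cauchy_coeff_def add_ac)

lemma gram_mat_inverse:
  assumes nz: "\<And>j k. j \<le> n \<Longrightarrow> k \<le> n \<Longrightarrow> \<alpha> j + cnj (\<alpha> k) + 1 \<noteq> 0"
    and inj: "inj_on \<alpha> {..<Suc n}"
  shows "gram_mat n \<alpha> * cauchy_inv (Suc n) \<alpha> (\<lambda>k. cnj (\<alpha> k) + 1) = 1\<^sub>m (Suc n)"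
    and "cauchy_inv (Suc n) \<alpha> (\<lambda>k. cnj (\<alpha> k) + 1) * gram_mat n \<alpha> = 1\<^sub>m (Suc n)"
  unfolding gram_mat_eq_cauchy_mat
  using nz inj by (auto intro!: cauchy_mat_inverse simp: inj_on_def add.assoc[symmetric])

section \<open>Lower bound for the smallest eigenvalue\<close>

lemma smallest_eigenvalue_gram_mat:
  assumes nz: "\<And>j k. j \<le> n \<Longrightarrow> k \<le> n \<Longrightarrow> \<alpha> j + cnj (\<alpha> k) + 1 \<noteq> 0"
    and pd: "positive_definite (gram_mat n \<alpha>)"
  shows "smallest_eigenvalue (gram_mat n \<alpha>) \<ge>
          inverse (\<Sum>l = 0..n.
            (\<Sum>j = 0..l.
               sqrt (1 + 2 * Re (\<alpha> l)) * (\<Prod>k<l. cmod (\<alpha> j + cnj (\<alpha> k) + 1)) /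
               (\<Prod>k \<in> {0..l} - {j}. cmod (\<alpha> j - \<alpha> k)))\<^sup>2)"
    (is "_ \<ge> inverse ?S")
proof -
  let ?y = "\<lambda>k. cnj (\<alpha> k) + 1"
  let ?c = "\<lambda>m j. cmod (cauchy_coeff \<alpha> ?y m j)"
  let ?G = "cauchy_inv (Suc n) \<alpha> ?y"
  let ?e = "\<lambda>m. 1 + 2 * Re (\<alpha> m)"
  define t where "t = smallest_eigenvalue (gram_mat n \<alpha>)"
  have M: "gram_mat n \<alpha> \<in> carrier_mat (Suc n) (Suc n)" by (simp add: gram_mat_def)
  have inj: "inj_on \<alpha> {..<Suc n}"
    using positive_definite_det_nonzero[OF pd] det_gram_mat_not_inj by blast
  \<comment> \<open>The \<open>m\<close>-th diagonal entry is \<open>1 / ?e m\<close>, positive by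
    definiteness. This justifies both squaring the root and dropping the modulus of
    \<open>?e m\<close>.\<close>
  have e: "?e m > 0" if "m \<le> n" for m
  proof -
    have "gram_mat n \<alpha> $$ (m, m) = complex_of_real (1 / ?e m)"
      using that add_cnj_add_1[of "\<alpha> m"] by (simp add: gram_mat_def add.assoc)
    moreover have "0 < Re (gram_mat n \<alpha> $$ (m, m))"
      using that M by (intro positive_definite_diag_pos[OF pd]) auto
    ultimately show ?thesis by (simp only: Re_complex_of_real zero_less_divide_1_iff)
  qed
  have S: "?S = (\<Sum>m = 0..n. ?e m * (\<Sum>j = 0..m. ?c m j)\<^sup>2)"
  proof (rule sum.cong[OF refl])
    fix m assume m: "m \<in> {0..n}"
    have "(\<Sum>j = 0..m. sqrt (?e m) * (\<Prod>k<m. cmod (\<alpha> j + cnj (\<alpha> k) + 1)) / (\<Prod>k\<in>{0..m} - {j}. cmod (\<alpha> j - \<alpha> k)))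
        = sqrt (?e m) * (\<Sum>j = 0..m. ?c m j)"
      by (simp add: cauchy_coeff_def norm_divide prod_norm sum_distrib_left add.assoc)
    then show "(\<Sum>j = 0..m. sqrt (?e m) * (\<Prod>k<m. cmod (\<alpha> j + cnj (\<alpha> k) + 1)) / (\<Prod>k\<in>{0..m} - {j}. cmod (\<alpha> j - \<alpha> k)))\<^sup>2
        = ?e m * (\<Sum>j = 0..m. ?c m j)\<^sup>2"
      using e[of m] m by (simp add: power_mult_distrib)
  qed
  have rows: "(\<Sum>k<Suc n. cmod (?G $$ (j, k))) \<le> ?S" if j: "j < Suc n" for j
  proof -
    have "(\<Sum>k<Suc n. cmod (?G $$ (j, k))) \<le> (\<Sum>k<Suc n. \<Sum>m = max j k..<Suc n. ?e m * ?c m j * ?c m k)"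
    proof (rule sum_mono)
      fix k assume k: "k \<in> {..<Suc n}"
      have "?G $$ (j, k) = (\<Sum>m = max j k..<Suc n. complex_of_real (?e m) * cnj (cauchy_coeff \<alpha> ?y m j) * cauchy_coeff \<alpha> ?y m k)"
        unfolding cauchy_inv_def cauchy_coeff_cnj add_cnj_add_1 using j k by simp
      also have "cmod \<dots> \<le> (\<Sum>m = max j k..<Suc n. ?e m * ?c m j * ?c m k)"
      proof (rule sum_norm_le)
        fix m assume "m \<in> {max j k..<Suc n}"
        then show "cmod (complex_of_real (?e m) * cnj (cauchy_coeff \<alpha> ?y m j) * cauchy_coeff \<alpha> ?y m k)
            \<le> ?e m * ?c m j * ?c m k"
          using e[of m] by (simp only: norm_mult norm_of_real complex_mod_cnj) simp
      qed
      finally show "cmod (?G $$ (j, k)) \<le> (\<Sum>m = max j k..<Suc n. ?e m * ?c m j * ?c m k)" .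
    qed
    \<comment> \<open>Turning the lower limit \<open>max j k\<close> into a condition makes the
      range of \<open>m\<close> independent of \<open>k\<close>, so the sums can be
      exchanged.\<close>
    also have "\<dots> = (\<Sum>k<Suc n. \<Sum>m = 0..n. if j \<le> m \<and> k \<le> m then ?e m * ?c m j * ?c m k else 0)"
      by (intro sum.cong[OF refl] sum.mono_neutral_cong_left) auto
    also have "\<dots> = (\<Sum>m = 0..n. \<Sum>k<Suc n. if j \<le> m \<and> k \<le> m then ?e m * ?c m j * ?c m k else 0)"
      by (rule sum.swap)
    also have "\<dots> \<le> (\<Sum>m = 0..n. ?e m * (\<Sum>j = 0..m. ?c m j)\<^sup>2)"
    proof (rule sum_mono)
      fix m assume m: "m \<in> {0..n}"
      show "(\<Sum>k<Suc n. if j \<le> m \<and> k \<le> m then ?e m * ?c m j * ?c m k else 0) \<le> ?e m * (\<Sum>j = 0..m. ?c m j)\<^sup>2"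
      proof (cases "j \<le> m")
        case True
        have "(\<Sum>k<Suc n. if j \<le> m \<and> k \<le> m then ?e m * ?c m j * ?c m k else 0)
            = (\<Sum>k = 0..m. ?e m * ?c m j * ?c m k)"
          using m True by (intro sum.mono_neutral_cong_right) auto
        also have "\<dots> = ?e m * ?c m j * (\<Sum>k = 0..m. ?c m k)"
          by (simp only: sum_distrib_left)
        \<comment> \<open>Enlarging the single term \<open>?c m j\<close> to the whole sum removes
          the dependence on the row \<open>j\<close> and produces the square.\<close>
        also have "\<dots> \<le> ?e m * (\<Sum>k = 0..m. ?c m k) * (\<Sum>k = 0..m. ?c m k)"
          using e[of m] m True
          by (intro mult_right_mono mult_left_mono member_le_sum sum_nonneg) auto
        finally show ?thesis by (simp add: power2_eq_square mult.assoc)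
      next
        case False
        then show ?thesis using e[of m] m by simp
      qed
    qed
    finally show ?thesis unfolding S .
  qed
  have ev: "eigenvalue (gram_mat n \<alpha>) (complex_of_real t)"
    unfolding t_def using M by (intro smallest_eigenvalue_mem[OF pd]) auto
  have t: "t > 0" using positive_definite_eigenvalue(2)[OF pd ev] by simp
  have "1 \<le> cmod (complex_of_real t) * ?S"
    using gram_mat_inverse(2)[OF nz inj] rows ev
    by (intro eigenvalue_ge_inverse_row_sum[OF M, of ?G]) (auto simp: cauchy_inv_def)
  \<comment> \<open>Proved for arbitrary \<open>S\<close> to keep the double sum opaque; positivity
    of \<open>S\<close> follows from \<open>1 \<le> t * S\<close> and \<open>t > 0\<close>.\<close>
  moreover have "inverse S \<le> t" if "1 \<le> cmod (complex_of_real t) * S" for S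
  proof -
    have "1 \<le> t * S" using that t by simp
    moreover from this have "0 < t * S" by linarith
    then have "0 < S" using t by (simp add: zero_less_mult_iff)
    ultimately show ?thesis by (simp add: inverse_eq_divide divide_le_eq)
  qed
  ultimately show ?thesis unfolding t_def[symmetric] by blast
qed

text \<open>As division by zero yields 0, \<open>entries_defined\<close> is what makes each entry a
  genuine quotient. The denominators run over \<open>{0..m} - {j}\<close> rather than stopping at
  \<open>m - 1\<close>: for \<open>j < m\<close> the factor at index \<open>m\<close> is part of the
  residue.\<close>

theorem theorem4:
  fixes n :: nat and \<alpha> :: "nat \<Rightarrow> complex"
  assumes entries_defined: "\<And>j k. j \<le> n \<Longrightarrow> k \<le> n \<Longrightarrow> \<alpha> j + cnj (\<alpha> k) + 1 \<noteq> 0"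
  shows
    "det (gram_mat n \<alpha>) =
       complex_of_real
         (\<Prod>k\<le>n. (\<Prod>j<k. (cmod (\<alpha> k - \<alpha> j))\<^sup>2) /
                ((1 + 2 * Re (\<alpha> k)) * (\<Prod>j<k. (cmod (\<alpha> k + cnj (\<alpha> j) + 1))\<^sup>2)))
     \<and>
     ((\<forall>j\<le>n. \<forall>k\<le>n. j \<noteq> k \<longrightarrow> \<alpha> j \<noteq> \<alpha> k) \<and>
      (\<forall>j\<le>n. \<forall>k\<le>n. Re (\<alpha> j) + Re (\<alpha> k) \<noteq> -1) \<longrightarrow>
        invertible_mat (gram_mat n \<alpha>) \<and>
        (let \<Gamma> = mat (Suc n) (Suc n) (\<lambda>(j, k).
           \<Sum>m = max j k..n.
             (complex_of_real (1 + 2 * Re (\<alpha> m)) *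
              (\<Prod>r<m. (cnj (\<alpha> j) + \<alpha> r + 1) * (\<alpha> k + cnj (\<alpha> r) + 1))) /
             ((\<Prod>p \<in> {0..m} - {j}. cnj (\<alpha> j) - cnj (\<alpha> p)) *
              (\<Prod>q \<in> {0..m} - {k}. \<alpha> k - \<alpha> q)))
         in inverts_mat (gram_mat n \<alpha>) \<Gamma> \<and> inverts_mat \<Gamma> (gram_mat n \<alpha>)))
     \<and>
     (positive_definite (gram_mat n \<alpha>) \<longrightarrow>
        smallest_eigenvalue (gram_mat n \<alpha>) \<ge>
          inverse (\<Sum>l = 0..n.
            (\<Sum>j = 0..l.
               sqrt (1 + 2 * Re (\<alpha> l)) * (\<Prod>k<l. cmod (\<alpha> j + cnj (\<alpha> k) + 1)) /
               (\<Prod>k \<in> {0..l} - {j}. cmod (\<alpha> j - \<alpha> k)))\<^sup>2))"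
  (is "?det \<and> (?dist \<longrightarrow> invertible_mat ?M \<and> ?inv) \<and> (positive_definite ?M \<longrightarrow> ?bound)")
proof (intro conjI impI)
  show ?det by (rule det_gram_mat[OF entries_defined])
  show ?bound if "positive_definite ?M"
    by (rule smallest_eigenvalue_gram_mat[OF entries_defined that])
  assume ?dist
  then have inj: "inj_on \<alpha> {..<Suc n}" unfolding inj_on_def by (metis lessThan_iff less_Suc_eq_le)
  let ?G = "cauchy_inv (Suc n) \<alpha> (\<lambda>k. cnj (\<alpha> k) + 1)"
  let ?\<Gamma> = "mat (Suc n) (Suc n) (\<lambda>(j, k).
           \<Sum>m = max j k..n.
             (complex_of_real (1 + 2 * Re (\<alpha> m)) *
              (\<Prod>r<m. (cnj (\<alpha> j) + \<alpha> r + 1) * (\<alpha> k + cnj (\<alpha> r) + 1))) /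
             ((\<Prod>p \<in> {0..m} - {j}. cnj (\<alpha> j) - cnj (\<alpha> p)) *
              (\<Prod>q \<in> {0..m} - {k}. \<alpha> k - \<alpha> q)))"
  \<comment> \<open>The summands match those of \<open>cauchy_inv\<close> once the paired product is
    split and the 1 is attached to the conjugated exponent.\<close>
  have fac: "e * (\<Prod>r<m. (cnj (\<alpha> j) + \<alpha> r + 1) * (\<alpha> k + cnj (\<alpha> r) + 1)) /
        ((\<Prod>p\<in>{0..m} - {j}. cnj (\<alpha> j) - cnj (\<alpha> p)) * (\<Prod>q\<in>{0..m} - {k}. \<alpha> k - \<alpha> q))
      = e * cauchy_coeff (\<lambda>k. cnj (\<alpha> k) + 1) \<alpha> m j * cauchy_coeff \<alpha> (\<lambda>k. cnj (\<alpha> k) + 1) m k"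
    for e j k m
  proof -
    have "(\<Prod>r<m. cnj (\<alpha> j) + \<alpha> r + 1) = (\<Prod>r<m. cnj (\<alpha> j) + 1 + \<alpha> r)"
      by (simp add: add_ac)
    moreover have "(\<Prod>r<m. \<alpha> k + cnj (\<alpha> r) + 1) = (\<Prod>r<m. \<alpha> k + (cnj (\<alpha> r) + 1))"
      by (simp add: add.assoc)
    ultimately show ?thesis
      by (simp add: cauchy_coeff_def prod.distrib)
  qed
  have G: "?\<Gamma> = ?G"
    unfolding cauchy_inv_def add_cnj_add_1 atLeastLessThanSuc_atLeastAtMost fac ..
  have inv: "inverts_mat ?M ?\<Gamma>" "inverts_mat ?\<Gamma> ?M"
    unfolding G inverts_mat_def using gram_mat_inverse[OF entries_defined inj]
    by (simp_all add: gram_mat_def cauchy_inv_def)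
  have "square_mat ?M" by (simp add: gram_mat_def)
  then show "invertible_mat ?M" unfolding invertible_mat_def using inv by blast
  show ?inv unfolding Let_def using inv by (rule conjI)
qed

end
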